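(* Let $M\subset\mathbb{C}$ be a simply connected domain, $z_0\in M$, and $L=1+\mathrm{i}e_1\in\mathbb{H}_{\mathbb{C}}$. Set $N_-:=e_3-\mathrm{i}e_2$ and $N_+:=e_3+\mathrm{i}e_2$. (Left branch.) Let $f,h\colon M\to\mathbb{C}$ be holomorphic, $A_0\in\operatorname{Sp}(1,\mathbb{C})$, and $B\colon M\to\operatorname{Sp}(1,\mathbb{C})$ an arbitrary holomorphic map. Let $F$ be the primitive of $f$ with $F(z_0)=0$ and set $$K(z):=e^{2\mathrm{i}F(z)}\int_{z_0}^{z}h(\zeta)\,e^{-2\mathrm{i}F(\zeta)}\,\mathrm{d}\zeta .$$ Then $$A(z)=A_0\bigl(\cos F(z)+\sin F(z)\,e_1\bigr)\bigl(1+K(z)N_-\bigr)$$ is the unique solution of $A'=A(fe_1+hN_-)$, $A(z_0)=A_0$, and satisfies $A^s\equiv1$. Hence $\Phi=ALB$ is a nowhere-vanishing holomorphic null curve and $X=\operatorname{Re}\int\Phi\,\mathrm{d}z$ is superminimal. (Right branch.) Let $g,k\colon M\to\mathbb{C}$ be holomorphic, $B_0\in\operatorname{Sp}(1,\mathbb{C})$, and $A\colon M\to\operatorname{Sp}(1,\mathbb{C})$ an arbitrary holomorphic map. Let $G$ be the primitive of $g$ with $G(z_0)=0$ and set $$R(z):=e^{2\mathrm{i}G(z)}\int_{z_0}^{z}k(\zeta)\,e^{-2\mathrm{i}G(\zeta)}\,\mathrm{d}\zeta .$$ Then $$B(z)=\bigl(1+R(z)N_+\bigr)\bigl(\cos G(z)+\sin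 G(z)\,e_1\bigr)B_0$$ is the unique solution of $B'=(ge_1+kN_+)B$, $B(z_0)=B_0$, and satisfies $B^s\equiv1$; the corresponding data $\Phi=ALB$ define a superminimal conformal minimal immersion $X=\operatorname{Re}\int\Phi\,\mathrm{d}z$. (Converse.) Every superminimal representation $\Phi=ALB$ (with this fixed $L$ and holomorphic $A,B\colon M\to\operatorname{Sp}(1,\mathbb{C})$) satisfying $\alpha:=A^cA'\in\mathfrak{p}_L^\ell$ pointwise (resp. $\beta:=B'B^c\in\mathfrak{p}_L^r$ pointwise) is locally, and globally on simply connected domains, obtained from the left (resp. right) branch above.
   Context: $\mathbb{H}_{\mathbb{C}}:=\mathbb{H}\otimes_{\mathbb{R}}\mathbb{C}$ is the algebra of complex quaternions: elements $q=q_0+q_1e_1+q_2e_2+q_3e_3$ with $q_j\in\mathbb{C}$, where the imaginary unit $\mathrm{i}\in\mathbb{C}$ commutes with $e_1,e_2,e_3$, and $e_1^2=e_2^2=e_3^2=-1$, $e_1e_2=e_3=-e_2e_1$, $e_2e_3=e_1=-e_3e_2$, $e_3e_1=e_2=-e_1e_3$. The conjugate is $q^c:=q_0-q_1e_1-q_2e_2-q_3e_3$ and the symmetrised norm is $q^s:=qq^c=q_0^2+q_1^2+q_2^2+q_3^2$. $\operatorname{Sp}(1,\mathbb{C}):=\{q\in\mathbb{H}_{\mathbb{C}}: q^s=1\}$. $\operatorname{Im}(\mathbb{H}_{\mathbb{C}})$ is the set of pure complex quaternions ($q_0=0$). Prime denotes $\mathrm{d}/\mathrm{d}z$. A holomorphic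 null curve is a holomorphic map $\Phi$ into $\mathbb{H}_{\mathbb{C}}$ with $\Phi^s\equiv0$. $\mathbb{H}_{\mathbb{C}}$ is identified with $\mathbb{C}^4$ via $q\leftrightarrow(q_0,q_1,q_2,q_3)$; $\operatorname{Re}$ is the componentwise real part $\mathbb{C}^4\to\mathbb{R}^4$, and $\int\Phi\,\mathrm{d}z$ denotes a holomorphic primitive of $\Phi$ (up to an additive constant). A representation $\Phi=ALB$ is called superminimal if $X=\operatorname{Re}\int\Phi\,\mathrm{d}z$ is superminimal. The infinitesimal projective stabilisers are $\mathfrak{p}_L^\ell=\{\gamma\in\operatorname{Im}(\mathbb{H}_{\mathbb{C}}):\gamma L\in\mathbb{C}L\}$ and $\mathfrak{p}_L^r=\{\gamma\in\operatorname{Im}(\mathbb{H}_{\mathbb{C}}):L\gamma\in\mathbb{C}L\}$; for $L=1+\mathrm{i}e_1$ they equal $\mathbb{C}e_1\oplus\mathbb{C}N_-$ and $\mathbb{C}e_1\oplus\mathbb{C}N_+$ respectively. With $z=u+\mathrm{i}v$, an immersion $X\colon M\to\mathbb{R}^4$ is conformal if $|X_u|^2=|X_v|^2=:e^{2\omega}$ and $\langle X_u,X_v\rangle=0$; it is minimal if moreover $X_{uu}+X_{vv}=0$ (equivalently the mean curvature vector vanishes). With $(\cdot)^\perp$ the orthogonal projection to the normal plane, put $\xi=\tfrac12e^{-2\omega}(X_{uu}-X_{vv})^\perp$ and $\eta=e^{-2\omega}(X_{uv})^\perp$. The curvature ellipse at a point is the image of the unit tangent circle under $w\mapsto\mathrm{II}(w,w)$,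 with $\mathrm{II}$ the second fundamental form; it is $\{\mathbf H+\xi\cos2\theta+\eta\sin2\theta\}$, where $\mathbf H$ is the mean curvature vector, and is called a circle (possibly degenerate to a point) iff $\langle\xi,\eta\rangle=0$ and $|\xi|=|\eta|$. A conformal immersion is superminimal if it is minimal and its curvature ellipse is a circle at every point. *)

theory Defs
  imports "HOL-Complex_Analysis.Complex_Analysis"
begin

text \<open>Complex quaternions \<open>q0 + q1 e1 + q2 e2 + q3 e3\<close>; the datatype is the identification
  with \<open>\<complex>\<^sup>4\<close>.\<close>

datatype cquat = CQuat (cq0: complex) (cq1: complex) (cq2: complex) (cq3: complex)

instantiation cquat :: ring_1
begin

definition zero_cquat :: cquat where "0 = CQuat 0 0 0 0"

definition one_cquat :: cquat where "1 = CQuat 1 0 0 0"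

definition plus_cquat :: "cquat \<Rightarrow> cquat \<Rightarrow> cquat" where
  "p + q = CQuat (cq0 p + cq0 q) (cq1 p + cq1 q) (cq2 p + cq2 q) (cq3 p + cq3 q)"

definition minus_cquat :: "cquat \<Rightarrow> cquat \<Rightarrow> cquat" where
  "p - q = CQuat (cq0 p - cq0 q) (cq1 p - cq1 q) (cq2 p - cq2 q) (cq3 p - cq3 q)"

definition uminus_cquat :: "cquat \<Rightarrow> cquat" where
  "- q = CQuat (- cq0 q) (- cq1 q) (- cq2 q) (- cq3 q)"

definition times_cquat :: "cquat \<Rightarrow> cquat \<Rightarrow> cquat" where
  "p * q = CQuat
     (cq0 p * cq0 q - cq1 p * cq1 q - cq2 p * cq2 q - cq3 p * cq3 q)
     (cq0 p * cq1 q + cq1 p * cq0 q + cq2 p * cq3 q - cq3 p * cq2 q)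
     (cq0 p * cq2 q - cq1 p * cq3 q + cq2 p * cq0 q + cq3 p * cq1 q)
     (cq0 p * cq3 q + cq1 p * cq2 q - cq2 p * cq1 q + cq3 p * cq0 q)"

instance
  by standard
    (simp_all add: zero_cquat_def one_cquat_def plus_cquat_def minus_cquat_def
      uminus_cquat_def times_cquat_def cquat.expand algebra_simps)

end

definition cq_scale :: "complex \<Rightarrow> cquat \<Rightarrow> cquat" (infixr "*\<^sub>C" 75) where
  "c *\<^sub>C q = CQuat (c * cq0 q) (c * cq1 q) (c * cq2 q) (c * cq3 q)"

definition qe1 :: cquat where "qe1 = CQuat 0 1 0 0"
definition qe2 :: cquat where "qe2 = CQuat 0 0 1 0"
definition qe3 :: cquat where "qe3 = CQuat 0 0 0 1"

lemma cquat_units: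
  "qe1 * qe1 = -1" "qe2 * qe2 = -1" "qe3 * qe3 = -1"
  "qe1 * qe2 = qe3" "qe2 * qe1 = - qe3"
  "qe2 * qe3 = qe1" "qe3 * qe2 = - qe1"
  "qe3 * qe1 = qe2" "qe1 * qe3 = - qe2"
  "q = cq0 q *\<^sub>C 1 + cq1 q *\<^sub>C qe1 + cq2 q *\<^sub>C qe2 + cq3 q *\<^sub>C qe3"
  by (simp_all add: qe1_def qe2_def qe3_def one_cquat_def times_cquat_def uminus_cquat_def
      plus_cquat_def cq_scale_def)

definition cq_conj :: "cquat \<Rightarrow> cquat" where
  "cq_conj q = CQuat (cq0 q) (- cq1 q) (- cq2 q) (- cq3 q)"

text \<open>The symmetrised norm \<open>q\<^sup>s\<close>; it is a complex scalar, kept here as an element of the algebra.\<close>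

definition cq_symm :: "cquat \<Rightarrow> cquat" where
  "cq_symm q = q * cq_conj q"

lemma cq_symm_eq:
  "cq_symm q = ((cq0 q)\<^sup>2 + (cq1 q)\<^sup>2 + (cq2 q)\<^sup>2 + (cq3 q)\<^sup>2) *\<^sub>C 1"
  by (simp add: cq_symm_def cq_conj_def times_cquat_def cq_scale_def one_cquat_def
      power2_eq_square)

definition Sp1C :: "cquat set" where
  "Sp1C = {q. cq_symm q = 1}"

definition cq_Im :: "cquat set" where
  "cq_Im = {q. cq0 q = 0}"

definition cq_Re :: "cquat \<Rightarrow> real ^ 4" where
  "cq_Re q = vector [Re (cq0 q), Re (cq1 q), Re (cq2 q), Re (cq3 q)]"


definition cq_holomorphic_on :: "(complex \<Rightarrow> cquat) \<Rightarrow> complex set \<Rightarrow> bool" where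
  "cq_holomorphic_on \<Phi> M \<longleftrightarrow>
     (\<lambda>z. cq0 (\<Phi> z)) holomorphic_on M \<and> (\<lambda>z. cq1 (\<Phi> z)) holomorphic_on M \<and>
     (\<lambda>z. cq2 (\<Phi> z)) holomorphic_on M \<and> (\<lambda>z. cq3 (\<Phi> z)) holomorphic_on M"

definition cq_deriv :: "(complex \<Rightarrow> cquat) \<Rightarrow> complex \<Rightarrow> cquat" where
  "cq_deriv \<Phi> z = CQuat (deriv (\<lambda>w. cq0 (\<Phi> w)) z) (deriv (\<lambda>w. cq1 (\<Phi> w)) z)
     (deriv (\<lambda>w. cq2 (\<Phi> w)) z) (deriv (\<lambda>w. cq3 (\<Phi> w)) z)"

definition null_curve_on :: "complex set \<Rightarrow> (complex \<Rightarrow> cquat) \<Rightarrow> bool" where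
  "null_curve_on M \<Phi> \<longleftrightarrow> cq_holomorphic_on \<Phi> M \<and> (\<forall>z\<in>M. cq_symm (\<Phi> z) = 0)"

definition primitive_on :: "complex set \<Rightarrow> (complex \<Rightarrow> complex) \<Rightarrow> (complex \<Rightarrow> complex) \<Rightarrow> bool" where
  "primitive_on M f F \<longleftrightarrow> (\<forall>z\<in>M. (F has_field_derivative f z) (at z))"

definition cq_primitive_on :: "complex set \<Rightarrow> (complex \<Rightarrow> cquat) \<Rightarrow> (complex \<Rightarrow> cquat) \<Rightarrow> bool" where
  "cq_primitive_on M \<Phi> P \<longleftrightarrow> cq_holomorphic_on P M \<and> (\<forall>z\<in>M. cq_deriv P z = \<Phi> z)"

text \<open>\<open>\<integral>\<^sub>z\<^sub>0\<^sup>z \<phi>(\<zeta>) d\<zeta>\<close> along some path in \<open>M\<close>. For \<open>\<phi>\<close> holomorphic on a simply connected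
  domain \<open>M\<close> the choice of the path is immaterial by Cauchy's theorem.\<close>

definition integral_from ::
    "complex set \<Rightarrow> complex \<Rightarrow> (complex \<Rightarrow> complex) \<Rightarrow> complex \<Rightarrow> complex" where
  "integral_from M z0 \<phi> z =
     contour_integral
       (SOME \<gamma>. valid_path \<gamma> \<and> path_image \<gamma> \<subseteq> M \<and> pathstart \<gamma> = z0 \<and> pathfinish \<gamma> = z) \<phi>"


text \<open>Surfaces \<open>X : M \<rightarrow> \<real>\<^sup>4\<close> on an open \<open>M \<subseteq> \<complex>\<close>, with \<open>z = u + \<i> v\<close>. The total function \<open>X\<close> is
  only relevant on \<open>M\<close>. Partial derivatives are values of the differential, which exists wherever
  they are used because immersions are smooth.\<close>

definition d_u :: "(complex \<Rightarrow> real ^ 4) \<Rightarrow> complex \<Rightarrow> real ^ 4" where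
  "d_u X z = frechet_derivative X (at z) 1"

definition d_v :: "(complex \<Rightarrow> real ^ 4) \<Rightarrow> complex \<Rightarrow> real ^ 4" where
  "d_v X z = frechet_derivative X (at z) \<i>"

primrec Ck_on :: "nat \<Rightarrow> complex set \<Rightarrow> (complex \<Rightarrow> real ^ 4) \<Rightarrow> bool" where
  "Ck_on 0 M X \<longleftrightarrow> continuous_on M X"
| "Ck_on (Suc k) M X \<longleftrightarrow>
     (\<forall>z\<in>M. X differentiable (at z)) \<and> Ck_on k M (d_u X) \<and> Ck_on k M (d_v X)"

definition smooth_on :: "complex set \<Rightarrow> (complex \<Rightarrow> real ^ 4) \<Rightarrow> bool" where
  "smooth_on M X \<longleftrightarrow> (\<forall>k. Ck_on k M X)"

definition immersion_on :: "complex set \<Rightarrow> (complex \<Rightarrow> real ^ 4) \<Rightarrow> bool" where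
  "immersion_on M X \<longleftrightarrow> smooth_on M X \<and> (\<forall>z\<in>M. inj (frechet_derivative X (at z)))"

definition conformal_immersion_on :: "complex set \<Rightarrow> (complex \<Rightarrow> real ^ 4) \<Rightarrow> bool" where
  "conformal_immersion_on M X \<longleftrightarrow> immersion_on M X \<and>
     (\<forall>z\<in>M. (norm (d_u X z))\<^sup>2 = (norm (d_v X z))\<^sup>2 \<and> d_u X z \<bullet> d_v X z = 0)"

definition conformal_minimal_immersion_on :: "complex set \<Rightarrow> (complex \<Rightarrow> real ^ 4) \<Rightarrow> bool" where
  "conformal_minimal_immersion_on M X \<longleftrightarrow> conformal_immersion_on M X \<and>
     (\<forall>z\<in>M. d_u (d_u X) z + d_v (d_v X) z = 0)"

definition tangent_plane :: "(complex \<Rightarrow> real ^ 4) \<Rightarrow> complex \<Rightarrow> (real ^ 4) set" where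
  "tangent_plane X z = span {d_u X z, d_v X z}"

text \<open>Orthogonal projection of \<open>w\<close> to the normal plane of \<open>X\<close> at \<open>z\<close>.\<close>

definition normal_part :: "(complex \<Rightarrow> real ^ 4) \<Rightarrow> complex \<Rightarrow> real ^ 4 \<Rightarrow> real ^ 4" where
  "normal_part X z w =
     (THE n. (\<forall>t\<in>tangent_plane X z. orthogonal t n) \<and> w - n \<in> tangent_plane X z)"

text \<open>Here \<open>e\<^sup>2\<^sup>\<omega>\<close> is \<open>(norm (d_u X z))\<^sup>2\<close>.\<close>

definition ellipse_xi :: "(complex \<Rightarrow> real ^ 4) \<Rightarrow> complex \<Rightarrow> real ^ 4" where
  "ellipse_xi X z =
     (1 / (2 * (norm (d_u X z))\<^sup>2)) *\<^sub>R normal_part X z (d_u (d_u X) z - d_v (d_v X) z)"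

definition ellipse_eta :: "(complex \<Rightarrow> real ^ 4) \<Rightarrow> complex \<Rightarrow> real ^ 4" where
  "ellipse_eta X z = (1 / (norm (d_u X z))\<^sup>2) *\<^sub>R normal_part X z (d_v (d_u X) z)"

text \<open>The curvature ellipse is \<open>{H + \<xi> cos 2\<theta> + \<eta> sin 2\<theta>}\<close>; a point counts as a circle.\<close>

definition curvature_ellipse_is_circle :: "(complex \<Rightarrow> real ^ 4) \<Rightarrow> complex \<Rightarrow> bool" where
  "curvature_ellipse_is_circle X z \<longleftrightarrow>
     ellipse_xi X z \<bullet> ellipse_eta X z = 0 \<and> norm (ellipse_xi X z) = norm (ellipse_eta X z)"

definition superminimal_on :: "complex set \<Rightarrow> (complex \<Rightarrow> real ^ 4) \<Rightarrow> bool" where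
  "superminimal_on M X \<longleftrightarrow>
     conformal_minimal_immersion_on M X \<and> (\<forall>z\<in>M. curvature_ellipse_is_circle X z)"


definition qL :: cquat where "qL = 1 + \<i> *\<^sub>C qe1"
definition N_minus :: cquat where "N_minus = qe3 - \<i> *\<^sub>C qe2"
definition N_plus :: cquat where "N_plus = qe3 + \<i> *\<^sub>C qe2"

definition stab_left :: "cquat \<Rightarrow> cquat set" where
  "stab_left L = {\<gamma>\<in>cq_Im. \<exists>c. \<gamma> * L = c *\<^sub>C L}"

definition stab_right :: "cquat \<Rightarrow> cquat set" where
  "stab_right L = {\<gamma>\<in>cq_Im. \<exists>c. L * \<gamma> = c *\<^sub>C L}"

definition Sp1C_map_on :: "complex set \<Rightarrow> (complex \<Rightarrow> cquat) \<Rightarrow> bool" where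
  "Sp1C_map_on M A \<longleftrightarrow> cq_holomorphic_on A M \<and> (\<forall>z\<in>M. A z \<in> Sp1C)"

text \<open>A representation \<open>\<Phi> = A L B\<close> whose surface \<open>Re \<integral> \<Phi> dz\<close> is superminimal. Primitives are taken
  on arbitrary open subsets, so that the notion makes sense on domains where \<open>\<Phi>\<close> has no global
  primitive; superminimality is local and insensitive to (locally) constant summands, so on a
  simply connected domain this says that \<open>Re P\<close> is superminimal for a global primitive \<open>P\<close>.\<close>

definition superminimal_representation_on ::
    "complex set \<Rightarrow> (complex \<Rightarrow> cquat) \<Rightarrow> cquat \<Rightarrow> (complex \<Rightarrow> cquat) \<Rightarrow> bool" where
  "superminimal_representation_on M A L B \<longleftrightarrow> Sp1C_map_on M A \<and> Sp1C_map_on M B \<and>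
     (\<forall>U P. open U \<and> U \<subseteq> M \<and> cq_primitive_on U (\<lambda>z. A z * L * B z) P \<longrightarrow>
        superminimal_on U (\<lambda>z. cq_Re (P z)))"

text \<open>\<open>K\<close> is \<open>branch_coeff M z0 F h\<close> and \<open>R\<close> is \<open>branch_coeff M z0 G k\<close>.\<close>

definition branch_coeff ::
    "complex set \<Rightarrow> complex \<Rightarrow> (complex \<Rightarrow> complex) \<Rightarrow> (complex \<Rightarrow> complex) \<Rightarrow> complex \<Rightarrow> complex" where
  "branch_coeff M z0 F h z =
     exp (2 * \<i> * F z) * integral_from M z0 (\<lambda>\<zeta>. h \<zeta> * exp (- 2 * \<i> * F \<zeta>)) z"

definition left_branch ::
    "complex set \<Rightarrow> complex \<Rightarrow> (complex \<Rightarrow> complex) \<Rightarrow> (complex \<Rightarrow> complex) \<Rightarrow> cquat \<Rightarrow> complex \<Rightarrow> cquat" where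
  "left_branch M z0 F h A0 z =
     A0 * (cos (F z) *\<^sub>C 1 + sin (F z) *\<^sub>C qe1) * (1 + branch_coeff M z0 F h z *\<^sub>C N_minus)"

definition right_branch ::
    "complex set \<Rightarrow> complex \<Rightarrow> (complex \<Rightarrow> complex) \<Rightarrow> (complex \<Rightarrow> complex) \<Rightarrow> cquat \<Rightarrow> complex \<Rightarrow> cquat" where
  "right_branch M z0 G k B0 z =
     (1 + branch_coeff M z0 G k z *\<^sub>C N_plus) * (cos (G z) *\<^sub>C 1 + sin (G z) *\<^sub>C qe1) * B0"

definition left_solution ::
    "complex set \<Rightarrow> complex \<Rightarrow> (complex \<Rightarrow> complex) \<Rightarrow> (complex \<Rightarrow> complex) \<Rightarrow> cquat \<Rightarrow> (complex \<Rightarrow> cquat) \<Rightarrow> bool" where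
  "left_solution M z0 f h A0 A \<longleftrightarrow> cq_holomorphic_on A M \<and> A z0 = A0 \<and>
     (\<forall>z\<in>M. cq_deriv A z = A z * (f z *\<^sub>C qe1 + h z *\<^sub>C N_minus))"

definition right_solution ::
    "complex set \<Rightarrow> complex \<Rightarrow> (complex \<Rightarrow> complex) \<Rightarrow> (complex \<Rightarrow> complex) \<Rightarrow> cquat \<Rightarrow> (complex \<Rightarrow> cquat) \<Rightarrow> bool" where
  "right_solution M z0 g k B0 B \<longleftrightarrow> cq_holomorphic_on B M \<and> B z0 = B0 \<and>
     (\<forall>z\<in>M. cq_deriv B z = (g z *\<^sub>C qe1 + k z *\<^sub>C N_plus) * B z)"

definition from_left_branch :: "complex set \<Rightarrow> complex \<Rightarrow> (complex \<Rightarrow> cquat) \<Rightarrow> bool" where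
  "from_left_branch M z0 A \<longleftrightarrow>
     (\<exists>f h F A0. f holomorphic_on M \<and> h holomorphic_on M \<and> A0 \<in> Sp1C \<and>
        primitive_on M f F \<and> F z0 = 0 \<and> (\<forall>z\<in>M. A z = left_branch M z0 F h A0 z))"

definition from_right_branch :: "complex set \<Rightarrow> complex \<Rightarrow> (complex \<Rightarrow> cquat) \<Rightarrow> bool" where
  "from_right_branch M z0 B \<longleftrightarrow>
     (\<exists>g k G B0. g holomorphic_on M \<and> k holomorphic_on M \<and> B0 \<in> Sp1C \<and>
        primitive_on M g G \<and> G z0 = 0 \<and> (\<forall>z\<in>M. B z = right_branch M z0 G k B0 z))"

end

theory Submission
  imports Defs
begin

text \<open>The complex bilinear form \<open>q \<mapsto> q\<^sup>s\<close> is multiplicative and \<open>L\<close> is isotropic, so every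
  product \<open>p L q\<close> is isotropic. If \<open>A' = A \<alpha>\<close> with \<open>\<alpha> L \<in> \<complex> L\<close> (or \<open>B' = \<beta> B\<close> with
  \<open>L \<beta> \<in> \<complex> L\<close>), then not only \<open>\<Phi> = A L B\<close> but also \<open>\<Phi>'\<close> has this form; and for a null curve
  the isotropy of \<open>\<Phi>'\<close> forces the curvature ellipse of \<open>Re \<integral> \<Phi> dz\<close> to be a circle. The
  solution formulas follow from \<open>N\<^sub>\<mp>\<^sup>2 = 0\<close> and \<open>e\<^sub>1 N\<^sub>\<mp> = \<mp>\<i> N\<^sub>\<mp> = - N\<^sub>\<mp> e\<^sub>1\<close>; the converse
  reads \<open>f, h\<close> off \<open>A\<^sup>c A'\<close> and uses uniqueness for the linear equation.\<close>

section \<open>Complex quaternion algebra\<close>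

lemmas cquat_simps = zero_cquat_def one_cquat_def plus_cquat_def minus_cquat_def
  uminus_cquat_def times_cquat_def cq_scale_def cq_conj_def qe1_def qe2_def qe3_def

text \<open>The complex bilinear, not Hermitian, extension of the Euclidean inner product. It takes
  scalar values, so that isotropy becomes an equation in the complex numbers.\<close>

definition cq_dot :: "cquat \<Rightarrow> cquat \<Rightarrow> complex" where
  "cq_dot p q = cq0 p * cq0 q + cq1 p * cq1 q + cq2 p * cq2 q + cq3 p * cq3 q"

lemma cq_symm_dot: "cq_symm q = cq_dot q q *\<^sub>C 1"
  by (simp add: cq_symm_eq cq_dot_def power2_eq_square)

lemma cq_symm_eq_1_iff: "cq_symm q = 1 \<longleftrightarrow> cq_dot q q = 1"
  by (simp add: cq_symm_dot cquat_simps)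

lemma cq_symm_eq_0_iff: "cq_symm q = 0 \<longleftrightarrow> cq_dot q q = 0"
  by (simp add: cq_symm_dot cquat_simps)

text \<open>Euler's four-square identity, valid over the complex numbers.\<close>

lemma cq_dot_mult_self: "cq_dot (p * q) (p * q) = cq_dot p p * cq_dot q q"
  by (simp add: cq_dot_def times_cquat_def algebra_simps)

lemma Sp1C_dot: "q \<in> Sp1C \<longleftrightarrow> cq_dot q q = 1"
  by (simp add: Sp1C_def cq_symm_eq_1_iff)

lemma Sp1C_mult: "p \<in> Sp1C \<Longrightarrow> q \<in> Sp1C \<Longrightarrow> p * q \<in> Sp1C"
  by (simp add: Sp1C_dot cq_dot_mult_self)

lemma cq_conj_mult: "cq_conj (p * q) = cq_conj q * cq_conj p"
  by (simp add: cquat_simps algebra_simps)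

lemma Sp1C_conj_right: "q \<in> Sp1C \<Longrightarrow> q * cq_conj q = 1"
  by (simp add: Sp1C_def cq_symm_def)

lemma Sp1C_conj_left: "q \<in> Sp1C \<Longrightarrow> cq_conj q * q = 1"
  by (simp add: Sp1C_dot cq_dot_def cquat_simps algebra_simps)

lemma cq_Im_conj: "q \<in> cq_Im \<Longrightarrow> cq_conj q = - q"
  by (simp add: cq_Im_def cquat_simps)

lemma qL_simps: "qL = CQuat 1 \<i> 0 0"
  by (simp add: qL_def cquat_simps)

lemma cq_dot_qL: "cq_dot qL qL = 0"
  by (simp add: qL_simps cq_dot_def)

lemma N_minus_simps: "N_minus = CQuat 0 0 (- \<i>) 1"
  by (simp add: N_minus_def cquat_simps)

lemma N_plus_simps: "N_plus = CQuat 0 0 \<i> 1"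
  by (simp add: N_plus_def cquat_simps)

lemma left_generator_qL: "(a *\<^sub>C qe1 + b *\<^sub>C N_minus) * qL = (- \<i> * a) *\<^sub>C qL"
  by (simp add: qL_simps N_minus_simps cquat_simps algebra_simps)

lemma right_generator_qL: "qL * (a *\<^sub>C qe1 + b *\<^sub>C N_plus) = (- \<i> * a) *\<^sub>C qL"
  by (simp add: qL_simps N_plus_simps cquat_simps algebra_simps)

lemma left_generator_Im: "a *\<^sub>C qe1 + b *\<^sub>C N_minus \<in> cq_Im"
  by (simp add: cq_Im_def N_minus_simps cquat_simps)

lemma right_generator_Im: "a *\<^sub>C qe1 + b *\<^sub>C N_plus \<in> cq_Im"
  by (simp add: cq_Im_def N_plus_simps cquat_simps)

text \<open>The last two coordinates of \<open>c *\<^sub>C qL\<close> vanish, and for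
  \<open>\<gamma> * qL\<close> either of them gives
  \<open>cq2 \<gamma> = - \<i> * cq3 \<gamma>\<close>. The coefficient of \<open>N_minus\<close> is
  therefore the \<open>qe3\<close> coordinate.\<close>

lemma stab_left_qL:
  assumes "\<gamma> \<in> stab_left qL"
  shows "\<gamma> = cq1 \<gamma> *\<^sub>C qe1 + cq3 \<gamma> *\<^sub>C N_minus"
proof -
  obtain c where "\<gamma> * qL = c *\<^sub>C qL" and "cq0 \<gamma> = 0"
    using assms by (auto simp: stab_left_def cq_Im_def)
  then show ?thesis
    by (cases \<gamma>) (auto simp: qL_simps N_minus_simps cquat_simps algebra_simps
        add_eq_0_iff)
qed

text \<open>Multiplying by \<open>qL\<close> on the other side flips the sign:
  \<open>cq2 \<gamma> = \<i> * cq3 \<gamma>\<close>.\<close>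

lemma stab_right_qL:
  assumes "\<gamma> \<in> stab_right qL"
  shows "\<gamma> = cq1 \<gamma> *\<^sub>C qe1 + cq3 \<gamma> *\<^sub>C N_plus"
proof -
  obtain c where "qL * \<gamma> = c *\<^sub>C qL" and "cq0 \<gamma> = 0"
    using assms by (auto simp: stab_right_def cq_Im_def)
  then show ?thesis
    by (cases \<gamma>) (auto simp: qL_simps N_plus_simps cquat_simps algebra_simps
        add_eq_0_iff)
qed

text \<open>The product is isotropic, so its norm cannot detect that it is nonzero. Instead the
  outer factors are inverted by their conjugates, which recovers \<open>qL\<close>.\<close>

lemma Sp1C_sandwich_nonzero:
  assumes "p \<in> Sp1C" "q \<in> Sp1C"
  shows "p * qL * q \<noteq> 0"
proof
  assume "p * qL * q = 0"
  then have "cq_conj p * (p * qL * q) * cq_conj q = 0"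
    by simp
  moreover have "cq_conj p * (p * qL * q) * cq_conj q = (cq_conj p * p) * qL * (q * cq_conj q)"
    by (simp add: mult.assoc)
  ultimately show False
    using assms by (simp add: Sp1C_conj_left Sp1C_conj_right qL_simps zero_cquat_def)
qed

section \<open>Derivatives of quaternion-valued maps\<close>

text \<open>Coordinatewise, since \<open>cquat\<close> is only a \<open>ring_1\<close>. As a
  relation it carries differentiability along with the value, unlike
  \<open>cq_deriv\<close>.\<close>

definition cq_has_deriv :: "(complex \<Rightarrow> cquat) \<Rightarrow> cquat \<Rightarrow> complex \<Rightarrow> bool" where
  "cq_has_deriv A D z \<longleftrightarrow>
     ((\<lambda>w. cq0 (A w)) has_field_derivative cq0 D) (at z) \<and>
     ((\<lambda>w. cq1 (A w)) has_field_derivative cq1 D) (at z) \<and>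
     ((\<lambda>w. cq2 (A w)) has_field_derivative cq2 D) (at z) \<and>
     ((\<lambda>w. cq3 (A w)) has_field_derivative cq3 D) (at z)"

lemma cq_has_deriv_imp_deriv: "cq_has_deriv A D z \<Longrightarrow> cq_deriv A z = D"
  by (auto simp: cq_has_deriv_def cq_deriv_def dest!: DERIV_imp_deriv)

lemma cq_holomorphic_has_deriv:
  "cq_holomorphic_on A M \<Longrightarrow> open M \<Longrightarrow> z \<in> M \<Longrightarrow> cq_has_deriv A (cq_deriv A z) z"
  by (auto simp: cq_has_deriv_def cq_deriv_def cq_holomorphic_on_def intro: holomorphic_derivI)

lemma cq_holomorphicI:
  "open M \<Longrightarrow> (\<And>z. z \<in> M \<Longrightarrow> cq_has_deriv A (D z) z) \<Longrightarrow> cq_holomorphic_on A M"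
  unfolding cq_holomorphic_on_def cq_has_deriv_def holomorphic_on_open
  by blast

lemma cq_has_deriv_mult:
  assumes "cq_has_deriv A D z" "cq_has_deriv B E z"
  shows "cq_has_deriv (\<lambda>w. A w * B w) (D * B z + A z * E) z"
  using assms unfolding cq_has_deriv_def
  by (auto simp: times_cquat_def plus_cquat_def intro!: derivative_eq_intros)

lemma cq_has_deriv_add:
  assumes "cq_has_deriv A D z" "cq_has_deriv B E z"
  shows "cq_has_deriv (\<lambda>w. A w + B w) (D + E) z"
  using assms unfolding cq_has_deriv_def
  by (auto simp: plus_cquat_def intro!: derivative_eq_intros)

lemma cq_has_deriv_const: "cq_has_deriv (\<lambda>w. q) 0 z"
  by (simp add: cq_has_deriv_def zero_cquat_def)

lemma cq_has_deriv_scale_const: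
  assumes "(a has_field_derivative a') (at z)"
  shows "cq_has_deriv (\<lambda>w. a w *\<^sub>C q) (a' *\<^sub>C q) z"
  using assms unfolding cq_has_deriv_def
  by (auto simp: cq_scale_def intro!: derivative_eq_intros)

lemma cq_has_deriv_conj:
  "cq_has_deriv A D z \<Longrightarrow> cq_has_deriv (\<lambda>w. cq_conj (A w)) (cq_conj D) z"
  unfolding cq_has_deriv_def
  by (auto simp: cq_conj_def intro!: derivative_eq_intros)

lemma cq_holomorphic_deriv:
  "cq_holomorphic_on A M \<Longrightarrow> open M \<Longrightarrow> cq_holomorphic_on (cq_deriv A) M"
  by (simp add: cq_holomorphic_on_def cq_deriv_def holomorphic_deriv)

lemma cq_holomorphic_scale:
  "cq_holomorphic_on A M \<Longrightarrow> cq_holomorphic_on (\<lambda>z. c *\<^sub>C A z) M"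
  by (auto simp: cq_holomorphic_on_def cq_scale_def intro!: holomorphic_intros)

lemma cq_holomorphic_mult:
  "cq_holomorphic_on A M \<Longrightarrow> cq_holomorphic_on B M \<Longrightarrow> cq_holomorphic_on (\<lambda>z. A z * B z) M"
  by (auto simp: cq_holomorphic_on_def times_cquat_def intro!: holomorphic_intros)

lemma cq_holomorphic_const: "cq_holomorphic_on (\<lambda>z. q) M"
  by (simp add: cq_holomorphic_on_def)

lemma cq_holomorphic_conj:
  "cq_holomorphic_on A M \<Longrightarrow> cq_holomorphic_on (\<lambda>z. cq_conj (A z)) M"
  by (auto simp: cq_holomorphic_on_def cq_conj_def intro!: holomorphic_intros)

lemma cq_has_deriv_0_imp_const:
  assumes "open M" "connected M" "\<And>z. z \<in> M \<Longrightarrow> cq_has_deriv A 0 z" "z \<in> M" "w \<in> M"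
  shows "A z = A w"
proof -
  have "(\<lambda>z. c (A z)) constant_on M" if "c \<in> {cq0, cq1, cq2, cq3}" for c
    using that assms(1-3)
    by (intro has_field_derivative_0_imp_constant_on) (auto simp: cq_has_deriv_def zero_cquat_def)
  then have "c (A z) = c (A w)" if "c \<in> {cq0, cq1, cq2, cq3}" for c
    using that assms(4,5) unfolding constant_on_def by metis
  then show ?thesis
    by (simp add: cquat.expand)
qed

section \<open>Primitives and path integrals\<close>

lemma global_primitive_simply_connected:
  assumes "open M" "simply_connected M" "f holomorphic_on M"
  shows "\<exists>F. \<forall>z\<in>M. (F has_field_derivative f z) (at z)"
proof -
  have "\<forall>f. f holomorphic_on M \<longrightarrow> (\<exists>h. \<forall>z. z \<in> M \<longrightarrow> (h has_field_derivative f z) (at z))"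
    using simply_connected_eq_global_primitive[OF assms(1)] assms(2) by simp
  then show ?thesis
    using assms(3) by blast
qed

lemma primitive_on_exists:
  assumes "open M" "simply_connected M" "f holomorphic_on M"
  shows "\<exists>F. primitive_on M f F \<and> F z0 = 0"
proof -
  obtain F where F: "\<And>z. z \<in> M \<Longrightarrow> (F has_field_derivative f z) (at z)"
    using global_primitive_simply_connected[OF assms] by blast
  have "primitive_on M f (\<lambda>z. F z - F z0)"
    unfolding primitive_on_def by (auto intro!: derivative_eq_intros F)
  then show ?thesis
    by (intro exI[of _ "\<lambda>z. F z - F z0"]) simp
qed

lemma cq_primitive_on_exists:
  assumes "open M" "simply_connected M" "cq_holomorphic_on \<Phi> M"
  shows "\<exists>P. cq_primitive_on M \<Phi> P"
proof -
  have "\<exists>p. \<forall>z\<in>M. (p has_field_derivative c (\<Phi> z)) (at z)" if "c \<in> {cq0, cq1, cq2, cq3}" for c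
    using assms(3) that
    by (intro global_primitive_simply_connected[OF assms(1,2)]) (auto simp: cq_holomorphic_on_def)
  from this[of cq0] this[of cq1] this[of cq2] this[of cq3] obtain P0 P1 P2 P3 where
    "\<forall>z\<in>M. (P0 has_field_derivative cq0 (\<Phi> z)) (at z)"
    "\<forall>z\<in>M. (P1 has_field_derivative cq1 (\<Phi> z)) (at z)"
    "\<forall>z\<in>M. (P2 has_field_derivative cq2 (\<Phi> z)) (at z)"
    "\<forall>z\<in>M. (P3 has_field_derivative cq3 (\<Phi> z)) (at z)"
    by auto
  then have "cq_has_deriv (\<lambda>z. CQuat (P0 z) (P1 z) (P2 z) (P3 z)) (\<Phi> z) z" if "z \<in> M" for z
    using that by (simp add: cq_has_deriv_def)
  then show ?thesis
    unfolding cq_primitive_on_def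
    using cq_holomorphicI[OF assms(1)] cq_has_deriv_imp_deriv by blast
qed

text \<open>Open connected sets are joined by polynomial paths, so \<open>SOME\<close> selects a
  genuine path; a primitive makes the value independent of which one.\<close>

lemma integral_from_primitive:
  assumes "open M" "connected M" "z0 \<in> M" "z \<in> M"
    and "\<And>w. w \<in> M \<Longrightarrow> (H has_field_derivative \<phi> w) (at w)"
  shows "integral_from M z0 \<phi> z = H z - H z0"
proof -
  let ?Q = "\<lambda>\<gamma>. valid_path \<gamma> \<and> path_image \<gamma> \<subseteq> M \<and> pathstart \<gamma> = z0 \<and> pathfinish \<gamma> = z"
  have "\<exists>\<gamma>. ?Q \<gamma>"
    using connected_open_polynomial_connected[OF assms(1-4)] valid_path_polynomial_function by blast
  then have "?Q (SOME \<gamma>. ?Q \<gamma>)"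
    by (rule someI_ex)
  then have "(\<phi> has_contour_integral (H z - H z0)) (SOME \<gamma>. ?Q \<gamma>)"
    using contour_integral_primitive[of M H \<phi> "SOME \<gamma>. ?Q \<gamma>"] assms(5)
    by (auto intro: has_field_derivative_at_within)
  then show ?thesis
    by (simp add: integral_from_def contour_integral_unique)
qed

section \<open>The surface of a null curve\<close>

lemma cq_Re_axis:
  "cq_Re q = Re (cq0 q) *\<^sub>R axis 1 1 + Re (cq1 q) *\<^sub>R axis 2 1 + Re (cq2 q) *\<^sub>R axis 3 1 + Re (cq3 q) *\<^sub>R axis 4 1"
  by (auto simp: cq_Re_def vec_eq_iff forall_4 axis_def vector_def)

lemma cq_Re_inner:
  "cq_Re p \<bullet> cq_Re q = Re (cq0 p) * Re (cq0 q) + Re (cq1 p) * Re (cq1 q)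
     + Re (cq2 p) * Re (cq2 q) + Re (cq3 p) * Re (cq3 q)"
  by (simp add: cq_Re_axis inner_add_left inner_add_right inner_axis_axis)

lemma cq_Re_diff: "cq_Re (p - q) = cq_Re p - cq_Re q"
  by (simp add: cq_Re_axis minus_cquat_def algebra_simps)

lemma cq_Re_ii_ii: "cq_Re (\<i> *\<^sub>C \<i> *\<^sub>C q) = - cq_Re q"
  by (simp add: cq_Re_axis cq_scale_def)

text \<open>Since the imaginary part of \<open>p\<close> is
  \<open>- cq_Re (\<i> *\<^sub>C p)\<close>, these are the real and imaginary parts of one complex
  equation. For p = q = \<Phi> they say that the surface is conformal.\<close>

lemma cq_dot_eq_0_iff:
  "cq_dot p q = 0 \<longleftrightarrow> cq_Re p \<bullet> cq_Re q = cq_Re (\<i> *\<^sub>C p) \<bullet> cq_Re (\<i> *\<^sub>C q) \<and>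
     cq_Re (\<i> *\<^sub>C p) \<bullet> cq_Re q = - (cq_Re p \<bullet> cq_Re (\<i> *\<^sub>C q))"
  by (auto simp: complex_eq_iff cq_dot_def cq_Re_inner cq_scale_def)

lemma cq_dot_scale_self: "cq_dot (c *\<^sub>C p) (c *\<^sub>C p) = c\<^sup>2 * cq_dot p p"
  by (simp add: cq_dot_def cq_scale_def power2_eq_square algebra_simps)

text \<open>Real and imaginary parts of an isotropic vector have equal length. This gives
  injectivity of the differential of the surface.\<close>

lemma cq_null_Re_eq_0:
  assumes "cq_dot p p = 0" "cq_Re p = 0"
  shows "p = 0"
proof -
  have "cq_Re (\<i> *\<^sub>C p) \<bullet> cq_Re (\<i> *\<^sub>C p) = 0"
    using assms cq_dot_eq_0_iff[of p p] by simp
  then have "cq_Re (\<i> *\<^sub>C p) = 0"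
    by simp
  then show ?thesis
    using assms(2)
    by (cases p) (auto simp: cq_Re_def vec_eq_iff forall_4 vector_def cq_scale_def zero_cquat_def
        complex_eq_iff)
qed

lemma cq_Re_has_derivative:
  assumes "cq_has_deriv P D z"
  shows "((\<lambda>w. cq_Re (P w)) has_derivative (\<lambda>h. cq_Re (h *\<^sub>C D))) (at z)"
proof -
  have "((\<lambda>w. c (P w)) has_derivative (\<lambda>h. c D * h)) (at z)" if "c \<in> {cq0, cq1, cq2, cq3}" for c
    using assms that by (auto simp: cq_has_deriv_def has_field_derivative_def)
  note * = this[of cq0, simplified] this[of cq1, simplified] this[of cq2, simplified]
    this[of cq3, simplified]
  show ?thesis
    unfolding cq_Re_axis cq_scale_def cquat.sel mult.commute[of _ "_ D"]
    by (intro has_derivative_add has_derivative_scaleR_left has_derivative_Re *)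
qed

text \<open>Agreement of \<open>X\<close> with \<open>cq_Re\<close> of \<open>P\<close> on an open
  set suffices, so the lemma applies again to \<open>d_u X\<close> and \<open>d_v X\<close>, which
  are controlled only on \<open>M\<close>.\<close>

lemma cq_Re_partials:
  assumes "open M" "z \<in> M" "\<And>w. w \<in> M \<Longrightarrow> X w = cq_Re (P w)" "cq_has_deriv P D z"
  shows "X differentiable (at z)" "frechet_derivative X (at z) = (\<lambda>h. cq_Re (h *\<^sub>C D))"
    "d_u X z = cq_Re D" "d_v X z = cq_Re (\<i> *\<^sub>C D)"
proof -
  have *: "(X has_derivative (\<lambda>h. cq_Re (h *\<^sub>C D))) (at z)"
    using has_derivative_transform_within_open[OF cq_Re_has_derivative[OF assms(4)] assms(1,2)]
      assms(3) by simp
  then show "X differentiable (at z)"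
    by (auto simp: differentiable_def)
  show F: "frechet_derivative X (at z) = (\<lambda>h. cq_Re (h *\<^sub>C D))"
    using frechet_derivative_at[OF *] by simp
  show "d_u X z = cq_Re D" "d_v X z = cq_Re (\<i> *\<^sub>C D)"
    by (simp_all add: d_u_def d_v_def F) (simp add: cq_scale_def)
qed

text \<open>Both partials of \<open>X\<close> are again real parts of holomorphic maps, namely of
  \<open>cq_deriv P\<close> and of \<i> times it. Hence \<open>P\<close> and \<open>X\<close> vary
  in the induction.\<close>

lemma cq_Re_Ck_on:
  assumes "open M" "cq_holomorphic_on P M" "\<And>w. w \<in> M \<Longrightarrow> X w = cq_Re (P w)"
  shows "Ck_on k M X"
  using assms(2,3)
proof (induction k arbitrary: P X)
  case 0
  have "X differentiable (at z)" if "z \<in> M" for z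
    using cq_Re_partials(1)[OF assms(1) that] 0 cq_holomorphic_has_deriv[OF _ assms(1) that] by blast
  then show ?case
    by (simp add: continuous_at_imp_continuous_on differentiable_imp_continuous_within)
next
  case (Suc k)
  note partials = cq_Re_partials[OF assms(1) _ Suc.prems(2)
      cq_holomorphic_has_deriv[OF Suc.prems(1) assms(1)]]
  have D: "cq_holomorphic_on (cq_deriv P) M"
    by (rule cq_holomorphic_deriv[OF Suc.prems(1) assms(1)])
  have "Ck_on k M (d_u X)"
    using Suc.IH[OF D] partials(3) by blast
  moreover have "Ck_on k M (d_v X)"
    using Suc.IH[OF cq_holomorphic_scale[OF D, of \<i>]] partials(4) by blast
  ultimately show ?case
    using partials(1) by simp
qed

section \<open>Normal projection and the curvature ellipse\<close>

text \<open>Replaces the definite description by the explicit projection along an orthogonal tangent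
  basis.\<close>

lemma normal_part_orthogonal:
  assumes "d_u X z \<bullet> d_v X z = 0" "d_u X z \<noteq> 0" "d_v X z \<noteq> 0"
  shows "normal_part X z w = w - ((w \<bullet> d_u X z) / (d_u X z \<bullet> d_u X z)) *\<^sub>R d_u X z
           - ((w \<bullet> d_v X z) / (d_v X z \<bullet> d_v X z)) *\<^sub>R d_v X z" (is "_ = ?n")
  unfolding normal_part_def
proof (rule the_equality)
  let ?T = "tangent_plane X z"
  have mem: "d_u X z \<in> ?T" "d_v X z \<in> ?T"
    by (auto simp: tangent_plane_def span_base)
  have T: "(\<forall>t\<in>?T. orthogonal t n) \<longleftrightarrow> d_u X z \<bullet> n = 0 \<and> d_v X z \<bullet> n = 0" for n
  proof
    assume "\<forall>t\<in>?T. orthogonal t n"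
    then show "d_u X z \<bullet> n = 0 \<and> d_v X z \<bullet> n = 0"
      using mem by (simp add: orthogonal_def)
  next
    assume *: "d_u X z \<bullet> n = 0 \<and> d_v X z \<bullet> n = 0"
    have "orthogonal n t" if "t \<in> ?T" for t
      using that unfolding tangent_plane_def
      by (rule orthogonal_to_span) (use * in \<open>auto simp: orthogonal_def inner_commute\<close>)
    then show "\<forall>t\<in>?T. orthogonal t n"
      by (simp add: orthogonal_commute)
  qed
  have sub: "subspace ?T"
    by (simp add: tangent_plane_def)
  have n: "d_u X z \<bullet> ?n = 0" "d_v X z \<bullet> ?n = 0"
    using assms by (simp_all add: inner_diff_right inner_commute)
  have wn: "w - ?n \<in> ?T"
  proof -
    have "w - ?n = ((w \<bullet> d_u X z) / (d_u X z \<bullet> d_u X z)) *\<^sub>R d_u X z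
        + ((w \<bullet> d_v X z) / (d_v X z \<bullet> d_v X z)) *\<^sub>R d_v X z"
      by simp
    also have "\<dots> \<in> ?T"
      by (intro subspace_add subspace_scale sub mem)
    finally show ?thesis .
  qed
  show "(\<forall>t\<in>?T. orthogonal t ?n) \<and> w - ?n \<in> ?T"
    unfolding T using n wn by blast
  \<comment> \<open>Two candidates differ by a tangent vector that is also normal, hence orthogonal
    to itself.\<close>
  fix m assume m: "(\<forall>t\<in>?T. orthogonal t m) \<and> w - m \<in> ?T"
  have "(w - ?n) - (w - m) \<in> ?T"
    using subspace_diff[OF sub wn] m by blast
  also have "(w - ?n) - (w - m) = m - ?n"
    by (simp only: diff_diff_eq2 diff_diff_eq) (simp add: algebra_simps)
  finally have mn: "m - ?n \<in> ?T" .
  have "d_u X z \<bullet> (m - ?n) = 0 \<and> d_v X z \<bullet> (m - ?n) = 0"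
    using m n unfolding T by (simp add: inner_diff_right)
  then have "orthogonal (m - ?n) (m - ?n)"
    using T mn by blast
  then show "m = ?n"
    by (simp add: orthogonal_def)
qed

text \<open>Differentiate the constant \<open>cq_dot (\<Phi> w) (\<Phi> w)\<close> by the product
  rule.\<close>

lemma cq_dot_null_deriv:
  assumes "open M" "z \<in> M" "\<And>w. w \<in> M \<Longrightarrow> cq_dot (\<Phi> w) (\<Phi> w) = 0" "cq_has_deriv \<Phi> D z"
  shows "cq_dot D (\<Phi> z) = 0"
proof -
  have "((\<lambda>w. cq_dot (\<Phi> w) (\<Phi> w)) has_field_derivative 2 * cq_dot D (\<Phi> z)) (at z)"
    using assms(4) unfolding cq_has_deriv_def cq_dot_def
    by (auto intro!: derivative_eq_intros)
  moreover have "((\<lambda>w. cq_dot (\<Phi> w) (\<Phi> w)) has_field_derivative 0) (at z)"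
    by (rule has_field_derivative_transform_within_open[OF DERIV_const assms(1,2)])
      (simp add: assms(3))
  ultimately have "2 * cq_dot D (\<Phi> z) = 0"
    by (rule DERIV_unique)
  then show ?thesis
    by simp
qed

text \<open>The complexified tangent plane is spanned by \<open>\<Phi>\<close> and its complex conjugate. As \<open>\<Phi>'\<close> is
  orthogonal to \<open>\<Phi>\<close>, its normal part differs from it by a multiple of \<open>\<Phi>\<close>, so the normal part is
  isotropic, i.e. the ellipse is a circle, as soon as \<open>\<Phi>'\<close> is.\<close>

lemma superminimal_of_isotropic_deriv:
  assumes M: "open M" and hol: "cq_holomorphic_on \<Phi> M" and P: "cq_primitive_on M \<Phi> P"
    and null: "\<And>z. z \<in> M \<Longrightarrow> cq_dot (\<Phi> z) (\<Phi> z) = 0"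
    and nz: "\<And>z. z \<in> M \<Longrightarrow> \<Phi> z \<noteq> 0"
    and iso: "\<And>z. z \<in> M \<Longrightarrow> cq_dot (cq_deriv \<Phi> z) (cq_deriv \<Phi> z) = 0"
  shows "superminimal_on M (\<lambda>z. cq_Re (P z))"
proof -
  define X where "X = (\<lambda>z. cq_Re (P z))"
  have Phol: "cq_holomorphic_on P M" and PD: "cq_has_deriv P (\<Phi> z) z" if "z \<in> M" for z
    using P that cq_holomorphic_has_deriv[OF _ M that, of P] by (auto simp: cq_primitive_on_def)
  have smooth: "smooth_on M X"
    unfolding smooth_on_def X_def
    using cq_Re_Ck_on[OF M, of P] P by (auto simp: cq_primitive_on_def)
  \<comment> \<open>Unfolding \<open>X_def\<close> lets \<open>refl\<close> discharge the agreement
    premise. Membership of the point in \<open>M\<close> remains as a premise twice, hence the later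
    \<open>OF z z\<close>.\<close>
  note X1 = cq_Re_partials[OF M _ _ PD, of _ X, unfolded X_def, OF _ refl, folded X_def]
  have D: "cq_has_deriv \<Phi> (cq_deriv \<Phi> z) z" if "z \<in> M" for z
    using cq_holomorphic_has_deriv[OF hol M that] .
  have D': "cq_has_deriv (\<lambda>w. \<i> *\<^sub>C \<Phi> w) (\<i> *\<^sub>C cq_deriv \<Phi> z) z" if "z \<in> M" for z
    using D[OF that] unfolding cq_has_deriv_def cq_scale_def
    by (auto intro!: derivative_eq_intros)
  have uu: "d_u (d_u X) z = cq_Re (cq_deriv \<Phi> z)"
    and vu: "d_v (d_u X) z = cq_Re (\<i> *\<^sub>C cq_deriv \<Phi> z)"
    and vv: "d_v (d_v X) z = - cq_Re (cq_deriv \<Phi> z)" if "z \<in> M" for z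
    using cq_Re_partials[OF M that X1(3) D[OF that]] cq_Re_partials[OF M that X1(4) D'[OF that]] that
    by (simp_all add: cq_Re_ii_ii)
  \<comment> \<open>The differential sends h to the real part of h \<Phi>. If it agrees at h and k,
    then (h - k) \<Phi> is isotropic with zero real part, hence zero.\<close>
  have inj: "inj (frechet_derivative X (at z))" if z: "z \<in> M" for z
  proof (rule injI)
    fix h k assume "frechet_derivative X (at z) h = frechet_derivative X (at z) k"
    then have "cq_Re (h *\<^sub>C \<Phi> z - k *\<^sub>C \<Phi> z) = 0"
      using X1(2)[OF z z] by (simp add: cq_Re_diff)
    moreover have "h *\<^sub>C \<Phi> z - k *\<^sub>C \<Phi> z = (h - k) *\<^sub>C \<Phi> z"
      by (simp add: cquat_simps algebra_simps)
    ultimately have "(h - k) *\<^sub>C \<Phi> z = 0"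
      using cq_null_Re_eq_0[of "(h - k) *\<^sub>C \<Phi> z"] null[OF z] by (simp add: cq_dot_scale_self)
    then show "h = k"
      using nz[OF z] by (cases "\<Phi> z") (auto simp: cq_scale_def zero_cquat_def)
  qed
  have conf: "d_u X z \<bullet> d_u X z = d_v X z \<bullet> d_v X z" "d_u X z \<bullet> d_v X z = 0" if z: "z \<in> M" for z
    using null[OF z] X1(3,4)[OF z z] by (auto simp: cq_dot_eq_0_iff inner_commute)
  have "conformal_minimal_immersion_on M X"
    unfolding conformal_minimal_immersion_on_def conformal_immersion_on_def immersion_on_def
    using smooth inj conf uu vv by (auto simp: power2_norm_eq_inner)
  moreover have "curvature_ellipse_is_circle X z" if z: "z \<in> M" for z
  proof -
    define x y where "x = d_u X z" and "y = d_v X z"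
    define v w where "v = cq_Re (cq_deriv \<Phi> z)" and "w = cq_Re (\<i> *\<^sub>C cq_deriv \<Phi> z)"
    define r a b where "r = x \<bullet> x" and "a = v \<bullet> x" and "b = v \<bullet> y"
    have "x \<noteq> 0"
      using nz[OF z] null[OF z] cq_null_Re_eq_0 X1(3)[OF z z] by (auto simp: x_def)
    then have r: "r > 0"
      by (simp add: r_def)
    have yy: "y \<bullet> y = r" and xy: "x \<bullet> y = 0"
      using conf[OF z] by (simp_all add: x_def y_def r_def)
    then have "y \<noteq> 0"
      using r by auto
    \<comment> \<open>Real and imaginary parts of the orthogonality of \<Phi>' and \<Phi>.\<close>
    have wx: "w \<bullet> x = - b" and wy: "w \<bullet> y = a"
      using cq_dot_null_deriv[OF M z null D[OF z]] X1(3,4)[OF z z]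
      by (auto simp: cq_dot_eq_0_iff a_def b_def v_def w_def x_def y_def)
    have vw: "v \<bullet> w = 0" "v \<bullet> v = w \<bullet> w"
      using iso[OF z] by (auto simp: cq_dot_eq_0_iff v_def w_def inner_commute)
    note np = normal_part_orthogonal[of X z, folded x_def y_def, OF xy \<open>x \<noteq> 0\<close> \<open>y \<noteq> 0\<close>,
        unfolded yy, folded r_def]
    \<comment> \<open>The normal parts of \<open>v\<close> and \<open>w\<close>. In complex terms m
      - \<i> n = \<Phi>' - ((a + \<i> b) / r) \<Phi>, a combination of two isotropic vectors
      orthogonal to each other; the real computation below expresses its isotropy.\<close>
    define m n where "m = v - (a / r) *\<^sub>R x - (b / r) *\<^sub>R y"
      and "n = w + (b / r) *\<^sub>R x - (a / r) *\<^sub>R y"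
    \<comment> \<open>X_vv = -X_uu, so the resulting factor 2 cancels the one in the denominator of
      \<open>ellipse_xi\<close>.\<close>
    have "v - - v = 2 *\<^sub>R v"
      by (simp add: scaleR_2)
    then have xi: "ellipse_xi X z = (1 / r) *\<^sub>R m"
      unfolding ellipse_xi_def np uu[OF z] vv[OF z] v_def[symmetric] x_def[symmetric]
        power2_norm_eq_inner r_def[symmetric]
      by (simp add: m_def scaleR_right_diff_distrib flip: a_def b_def)
    have eta: "ellipse_eta X z = (1 / r) *\<^sub>R n"
      unfolding ellipse_eta_def np vu[OF z] w_def[symmetric] x_def[symmetric]
        power2_norm_eq_inner r_def[symmetric]
      by (simp add: n_def wx wy)
    have products: "x \<bullet> x = r" "y \<bullet> x = 0" "v \<bullet> x = a" "x \<bullet> v = a" "v \<bullet> y = b" "y \<bullet> v = b"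
      "x \<bullet> w = - b" "y \<bullet> w = a" "w \<bullet> v = 0"
      using xy wx wy vw by (simp_all add: r_def a_def b_def inner_commute)
    have "m \<bullet> n = 0"
      using r unfolding m_def n_def
      by (simp add: inner_add_left inner_add_right inner_diff_left inner_diff_right
          products xy yy wx wy vw(1))
    moreover have "m \<bullet> m = n \<bullet> n"
      using r unfolding m_def n_def
      by (simp add: inner_add_left inner_add_right inner_diff_left inner_diff_right
          products xy yy wx wy vw)
    ultimately show ?thesis
      by (simp add: curvature_ellipse_is_circle_def xi eta norm_eq_sqrt_inner)
  qed
  ultimately show ?thesis
    by (simp add: superminimal_on_def X_def)
qed

section \<open>The two branches\<close>

text \<open>Variation of constants for K' = h + 2 \<i> f K with K(z0) = 0, the scalar equation left
  over once the rotation factor is split off.\<close>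

lemma branch_coeff_deriv:
  assumes "open M" "simply_connected M" "z0 \<in> M" "h holomorphic_on M" "primitive_on M f F"
  shows "branch_coeff M z0 F h z0 = 0"
    and "z \<in> M \<Longrightarrow> (branch_coeff M z0 F h has_field_derivative
           (h z + 2 * \<i> * f z * branch_coeff M z0 F h z)) (at z)"
proof -
  have M: "connected M"
    using assms(2) by (rule simply_connected_imp_connected)
  have F: "(F has_field_derivative f w) (at w)" if "w \<in> M" for w
    using assms(5) that by (simp add: primitive_on_def)
  then have "F holomorphic_on M"
    using assms(1) holomorphic_on_open by blast
  then have "(\<lambda>\<zeta>. h \<zeta> * exp (- 2 * \<i> * F \<zeta>)) holomorphic_on M"
    using assms(4) by (intro holomorphic_intros)
  then obtain H where
    H: "\<And>w. w \<in> M \<Longrightarrow> (H has_field_derivative h w * exp (- 2 * \<i> * F w)) (at w)"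
    using global_primitive_simply_connected[OF assms(1,2)] by blast
  have eq: "branch_coeff M z0 F h w = exp (2 * \<i> * F w) * (H w - H z0)" if "w \<in> M" for w
    unfolding branch_coeff_def
    using integral_from_primitive[OF assms(1) M assms(3) that H] by simp
  then show "branch_coeff M z0 F h z0 = 0"
    using assms(3) by simp
  assume z: "z \<in> M"
  have "((\<lambda>w. exp (2 * \<i> * F w) * (H w - H z0)) has_field_derivative
      2 * \<i> * f z * exp (2 * \<i> * F z) * (H z - H z0)
        + exp (2 * \<i> * F z) * (h z * exp (- 2 * \<i> * F z))) (at z)"
    by (auto intro!: derivative_eq_intros F[OF z] H[OF z])
  also have "2 * \<i> * f z * exp (2 * \<i> * F z) * (H z - H z0)
        + exp (2 * \<i> * F z) * (h z * exp (- 2 * \<i> * F z))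
      = h z + 2 * \<i> * f z * branch_coeff M z0 F h z"
    by (simp add: eq[OF z] exp_minus)
  \<comment> \<open>The closed form with \<open>H\<close> is known only on \<open>M\<close>, so the
    derivative is transferred through this open set.\<close>
  finally show "(branch_coeff M z0 F h has_field_derivative
      (h z + 2 * \<i> * f z * branch_coeff M z0 F h z)) (at z)"
    by (rule has_field_derivative_transform_within_open[OF _ assms(1) z]) (simp add: eq)
qed

lemma rotation_Sp1C: "cos c *\<^sub>C 1 + sin c *\<^sub>C qe1 \<in> Sp1C"
  by (simp add: Sp1C_dot cq_dot_def cquat_simps flip: power2_eq_square)

text \<open>\<open>N_minus\<close> is isotropic and orthogonal to 1 for
  \<open>cq_dot\<close>.\<close>

lemma left_unipotent_Sp1C: "1 + c *\<^sub>C N_minus \<in> Sp1C"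
  by (simp add: Sp1C_dot cq_dot_def N_minus_simps cquat_simps algebra_simps)

lemma right_unipotent_Sp1C: "1 + c *\<^sub>C N_plus \<in> Sp1C"
  by (simp add: Sp1C_dot cq_dot_def N_plus_simps cquat_simps algebra_simps)

lemma left_branch_Sp1C: "A0 \<in> Sp1C \<Longrightarrow> left_branch M z0 F h A0 z \<in> Sp1C"
  by (simp add: left_branch_def Sp1C_mult rotation_Sp1C left_unipotent_Sp1C)

lemma right_branch_Sp1C: "B0 \<in> Sp1C \<Longrightarrow> right_branch M z0 G k B0 z \<in> Sp1C"
  by (simp add: right_branch_def Sp1C_mult rotation_Sp1C right_unipotent_Sp1C)

lemma rotation_has_deriv:
  assumes "(F has_field_derivative c) (at z)"
  shows "cq_has_deriv (\<lambda>w. cos (F w) *\<^sub>C 1 + sin (F w) *\<^sub>C qe1)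
           (c *\<^sub>C (cos (F z) *\<^sub>C qe1 - sin (F z) *\<^sub>C 1)) z"
  using assms unfolding cq_has_deriv_def
  by (auto simp: cquat_simps intro!: derivative_eq_intros)

lemma unipotent_has_deriv:
  assumes "(K has_field_derivative c) (at z)"
  shows "cq_has_deriv (\<lambda>w. 1 + K w *\<^sub>C N) (c *\<^sub>C N) z"
  using cq_has_deriv_add[OF cq_has_deriv_const cq_has_deriv_scale_const[OF assms], of 1] by simp

lemma left_branch_solution:
  assumes "open M" "simply_connected M" "z0 \<in> M" "h holomorphic_on M" "primitive_on M f F" "F z0 = 0"
  shows "left_solution M z0 f h A0 (left_branch M z0 F h A0)"
proof -
  let ?A = "left_branch M z0 F h A0" and ?K = "branch_coeff M z0 F h"
  have deriv: "cq_has_deriv ?A (?A z * (f z *\<^sub>C qe1 + h z *\<^sub>C N_minus)) z" if z: "z \<in> M" for z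
  proof -
    let ?E = "cos (F z) *\<^sub>C 1 + sin (F z) *\<^sub>C qe1"
      and ?E' = "f z *\<^sub>C (cos (F z) *\<^sub>C qe1 - sin (F z) *\<^sub>C 1)"
      and ?K' = "h z + 2 * \<i> * f z * ?K z"
    \<comment> \<open>Stated for arbitrary quaternions so that \<open>A0\<close> is factored out
      before any coordinates are expanded.\<close>
    have factor: "(0 * a + A0 * b) * c + A0 * a * d = A0 * (b * c + a * d)" for a b c d :: cquat
      by (simp add: mult.assoc distrib_left)
    have "(F has_field_derivative f z) (at z)"
      using assms(5) z by (simp add: primitive_on_def)
    then have "cq_has_deriv ?A ((0 * ?E + A0 * ?E') * (1 + ?K z *\<^sub>C N_minus)
        + A0 * ?E * (?K' *\<^sub>C N_minus)) z"
      unfolding left_branch_def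
      by (intro cq_has_deriv_mult cq_has_deriv_const rotation_has_deriv unipotent_has_deriv
          branch_coeff_deriv(2)[OF assms(1-5) z])
    also have "(0 * ?E + A0 * ?E') * (1 + ?K z *\<^sub>C N_minus) + A0 * ?E * (?K' *\<^sub>C N_minus)
        = A0 * (?E' * (1 + ?K z *\<^sub>C N_minus) + ?E * (?K' *\<^sub>C N_minus))"
      by (rule factor)
    \<comment> \<open>The commutator of \<open>qe1\<close> and \<open>N_minus\<close> is -2 \<i>
      \<open>N_minus\<close>; the summand 2 \<i> f K of \<open>?K'\<close> compensates it.\<close>
    also have "?E' * (1 + ?K z *\<^sub>C N_minus) + ?E * (?K' *\<^sub>C N_minus)
        = ?E * (1 + ?K z *\<^sub>C N_minus) * (f z *\<^sub>C qe1 + h z *\<^sub>C N_minus)"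
      by (simp add: N_minus_simps cquat_simps algebra_simps)
    finally show ?thesis
      unfolding left_branch_def by (simp add: mult.assoc)
  qed
  have "?A z0 = A0"
    by (simp add: left_branch_def branch_coeff_deriv(1)[OF assms(1-5)] assms(6))
      (simp add: cquat_simps)
  then show ?thesis
    using cq_holomorphicI[OF assms(1) deriv] cq_has_deriv_imp_deriv[OF deriv]
    by (simp add: left_solution_def)
qed

lemma right_branch_solution:
  assumes "open M" "simply_connected M" "z0 \<in> M" "k holomorphic_on M" "primitive_on M g G" "G z0 = 0"
  shows "right_solution M z0 g k B0 (right_branch M z0 G k B0)"
proof -
  let ?B = "right_branch M z0 G k B0" and ?R = "branch_coeff M z0 G k"
  have deriv: "cq_has_deriv ?B ((g z *\<^sub>C qe1 + k z *\<^sub>C N_plus) * ?B z) z" if z: "z \<in> M" for z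
  proof -
    let ?E = "cos (G z) *\<^sub>C 1 + sin (G z) *\<^sub>C qe1"
      and ?E' = "g z *\<^sub>C (cos (G z) *\<^sub>C qe1 - sin (G z) *\<^sub>C 1)"
      and ?R' = "k z + 2 * \<i> * g z * ?R z"
    have "(G has_field_derivative g z) (at z)"
      using assms(5) z by (simp add: primitive_on_def)
    then have "cq_has_deriv ?B (((?R' *\<^sub>C N_plus) * ?E + (1 + ?R z *\<^sub>C N_plus) * ?E') * B0
        + (1 + ?R z *\<^sub>C N_plus) * ?E * 0) z"
      unfolding right_branch_def
      by (intro cq_has_deriv_mult cq_has_deriv_const rotation_has_deriv unipotent_has_deriv
          branch_coeff_deriv(2)[OF assms(1-5) z])
    \<comment> \<open>\<open>N_plus\<close> has opposite commutation signs, but the factors are also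
      in opposite order. The same coefficient 2 \<i> results, so \<open>branch_coeff\<close> serves
      both branches.\<close>
    also have "(?R' *\<^sub>C N_plus) * ?E + (1 + ?R z *\<^sub>C N_plus) * ?E'
        = (g z *\<^sub>C qe1 + k z *\<^sub>C N_plus) * ((1 + ?R z *\<^sub>C N_plus) * ?E)"
      by (simp add: N_plus_simps cquat_simps algebra_simps)
    finally show ?thesis
      unfolding right_branch_def by (simp add: mult.assoc)
  qed
  have "?B z0 = B0"
    by (simp add: right_branch_def branch_coeff_deriv(1)[OF assms(1-5)] assms(6))
      (simp add: cquat_simps)
  then show ?thesis
    using cq_holomorphicI[OF assms(1) deriv] cq_has_deriv_imp_deriv[OF deriv]
    by (simp add: right_solution_def)
qed

text \<open>For two solutions of \<open>A' = A \<alpha>\<close> with \<open>\<alpha>\<close> purely imaginary, the product of one with the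
  conjugate of the other is constant.\<close>

lemma left_solution_unique:
  assumes M: "open M" "connected M" "z0 \<in> M" "z \<in> M"
    and A: "left_solution M z0 f h A0 A" "\<And>w. w \<in> M \<Longrightarrow> A w \<in> Sp1C"
    and A': "left_solution M z0 f h A0 A'"
  shows "A' z = A z"
proof -
  have "cq_has_deriv (\<lambda>w. A' w * cq_conj (A w)) 0 w" if w: "w \<in> M" for w
  proof -
    define \<alpha> where "\<alpha> = f w *\<^sub>C qe1 + h w *\<^sub>C N_minus"
    have conj: "cq_conj \<alpha> = - \<alpha>"
      unfolding \<alpha>_def by (rule cq_Im_conj[OF left_generator_Im])
    have "cq_has_deriv A (A w * \<alpha>) w" "cq_has_deriv A' (A' w * \<alpha>) w"
      using A(1) A' cq_holomorphic_has_deriv[OF _ M(1) w] w unfolding \<alpha>_def by (metis left_solution_def)+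
    then have "cq_has_deriv (\<lambda>w. A' w * cq_conj (A w))
        (A' w * \<alpha> * cq_conj (A w) + A' w * cq_conj (A w * \<alpha>)) w"
      by (intro cq_has_deriv_mult cq_has_deriv_conj)
    then show ?thesis
      by (simp add: cq_conj_mult conj mult.assoc)
  qed
  then have "A' z * cq_conj (A z) = A' z0 * cq_conj (A z0)"
    by (rule cq_has_deriv_0_imp_const[OF M(1,2) _ M(4,3)])
  also have "A' z0 = A z0"
    using A(1) A' by (simp add: left_solution_def)
  finally have "A' z * cq_conj (A z) = 1"
    using A(2)[OF M(3)] by (simp add: Sp1C_conj_right)
  \<comment> \<open>Only \<open>A z\<close> is inverted, so the comparison covers solutions
    \<open>A'\<close> not known to take values in \<open>Sp1C\<close>.\<close>
  then have "A' z * (cq_conj (A z) * A z) = A z"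
    by (simp flip: mult.assoc)
  then show ?thesis
    using A(2)[OF M(4)] by (simp add: Sp1C_conj_left)
qed

text \<open>With the coefficient acting from the left, the conjugate must stand on the left for the
  two derivative terms to cancel.\<close>

lemma right_solution_unique:
  assumes M: "open M" "connected M" "z0 \<in> M" "z \<in> M"
    and B: "right_solution M z0 g k B0 B" "\<And>w. w \<in> M \<Longrightarrow> B w \<in> Sp1C"
    and B': "right_solution M z0 g k B0 B'"
  shows "B' z = B z"
proof -
  have "cq_has_deriv (\<lambda>w. cq_conj (B w) * B' w) 0 w" if w: "w \<in> M" for w
  proof -
    define \<beta> where "\<beta> = g w *\<^sub>C qe1 + k w *\<^sub>C N_plus"
    have conj: "cq_conj \<beta> = - \<beta>"
      unfolding \<beta>_def by (rule cq_Im_conj[OF right_generator_Im])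
    have "cq_has_deriv B (\<beta> * B w) w" "cq_has_deriv B' (\<beta> * B' w) w"
      using B(1) B' cq_holomorphic_has_deriv[OF _ M(1) w] w unfolding \<beta>_def by (metis right_solution_def)+
    then have "cq_has_deriv (\<lambda>w. cq_conj (B w) * B' w)
        (cq_conj (\<beta> * B w) * B' w + cq_conj (B w) * (\<beta> * B' w)) w"
      by (intro cq_has_deriv_mult cq_has_deriv_conj)
    then show ?thesis
      by (simp add: cq_conj_mult conj mult.assoc)
  qed
  then have "cq_conj (B z) * B' z = cq_conj (B z0) * B' z0"
    by (rule cq_has_deriv_0_imp_const[OF M(1,2) _ M(4,3)])
  also have "B' z0 = B z0"
    using B(1) B' by (simp add: right_solution_def)
  finally have "cq_conj (B z) * B' z = 1"
    using B(2)[OF M(3)] by (simp add: Sp1C_conj_left)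
  then have "(B z * cq_conj (B z)) * B' z = B z"
    by (simp add: mult.assoc)
  then show ?thesis
    using B(2)[OF M(4)] by (simp add: Sp1C_conj_right)
qed

section \<open>Superminimality of the represented surfaces\<close>

lemma null_curve_representation:
  assumes "Sp1C_map_on M A" "Sp1C_map_on M B"
  shows "null_curve_on M (\<lambda>z. A z * qL * B z)"
  using assms unfolding null_curve_on_def Sp1C_map_on_def
  by (auto simp: cq_symm_eq_0_iff cq_dot_mult_self cq_dot_qL
      intro!: cq_holomorphic_mult cq_holomorphic_const)

text \<open>The common endpoint of both branches. A product with \<open>qL\<close> in the middle is
  isotropic whatever its outer factors, so \<open>p\<close> and \<open>q\<close> may be arbitrary
  quaternions.\<close>

lemma superminimal_of_stabiliser:
  assumes M: "open M" and A: "Sp1C_map_on M A" and B: "Sp1C_map_on M B"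
    and P: "cq_primitive_on M (\<lambda>z. A z * qL * B z) P"
    and iso: "\<And>z. z \<in> M \<Longrightarrow>
      \<exists>p q. cq_deriv A z * qL * B z + A z * qL * cq_deriv B z = p * qL * q"
  shows "superminimal_on M (\<lambda>z. cq_Re (P z))"
proof (rule superminimal_of_isotropic_deriv[OF M _ P])
  show "cq_holomorphic_on (\<lambda>z. A z * qL * B z) M"
    using null_curve_representation[OF A B] by (simp add: null_curve_on_def)
  show "A z * qL * B z \<noteq> 0" if "z \<in> M" for z
    using A B that by (intro Sp1C_sandwich_nonzero) (auto simp: Sp1C_map_on_def)
  show "cq_dot (A z * qL * B z) (A z * qL * B z) = 0" for z
    by (simp add: cq_dot_mult_self cq_dot_qL)
  fix z assume z: "z \<in> M"
  have "cq_has_deriv A (cq_deriv A z) z" "cq_has_deriv B (cq_deriv B z) z"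
    using A B cq_holomorphic_has_deriv[OF _ M z] by (auto simp: Sp1C_map_on_def)
  then have "cq_has_deriv (\<lambda>z. A z * qL * B z)
      ((cq_deriv A z * qL + A z * 0) * B z + A z * qL * cq_deriv B z) z"
    by (intro cq_has_deriv_mult cq_has_deriv_const)
  then have "cq_deriv (\<lambda>z. A z * qL * B z) z = cq_deriv A z * qL * B z + A z * qL * cq_deriv B z"
    using cq_has_deriv_imp_deriv by fastforce
  then show "cq_dot (cq_deriv (\<lambda>z. A z * qL * B z) z) (cq_deriv (\<lambda>z. A z * qL * B z) z) = 0"
    using iso[OF z] by (auto simp: cq_dot_mult_self cq_dot_qL)
qed

text \<open>The generator acts on \<open>qL\<close> by a scalar, so both summands of the product
  rule share the left factor \<open>A z * qL\<close>.\<close>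

lemma left_solution_superminimal:
  assumes M: "open M" and A: "Sp1C_map_on M A" and B: "Sp1C_map_on M B"
    and sol: "left_solution M z0 f h A0 A"
    and P: "cq_primitive_on M (\<lambda>z. A z * qL * B z) P"
  shows "superminimal_on M (\<lambda>z. cq_Re (P z))"
proof (rule superminimal_of_stabiliser[OF M A B P])
  fix z assume "z \<in> M"
  then have "cq_deriv A z * qL = A z * ((- \<i> * f z) *\<^sub>C qL)"
    using sol by (simp add: left_solution_def mult.assoc left_generator_qL)
  then have "cq_deriv A z * qL * B z + A z * qL * cq_deriv B z
      = A z * qL * ((- \<i> * f z) *\<^sub>C B z + cq_deriv B z)"
    by (simp add: distrib_left) (simp add: cquat_simps algebra_simps)
  then show "\<exists>p q. cq_deriv A z * qL * B z + A z * qL * cq_deriv B z = p * qL * q"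
    by blast
qed

text \<open>Here the shared factor is \<open>qL * B z\<close>, on the right.\<close>

lemma right_solution_superminimal:
  assumes M: "open M" and A: "Sp1C_map_on M A" and B: "Sp1C_map_on M B"
    and sol: "right_solution M z0 g k B0 B"
    and P: "cq_primitive_on M (\<lambda>z. A z * qL * B z) P"
  shows "superminimal_on M (\<lambda>z. cq_Re (P z))"
proof (rule superminimal_of_stabiliser[OF M A B P])
  fix z assume "z \<in> M"
  then have "qL * cq_deriv B z = ((- \<i> * g z) *\<^sub>C qL) * B z"
    using sol by (simp add: right_solution_def right_generator_qL flip: mult.assoc)
  then have "A z * qL * cq_deriv B z = A z * ((- \<i> * g z) *\<^sub>C qL) * B z"
    by (simp add: mult.assoc)
  then have "cq_deriv A z * qL * B z + A z * qL * cq_deriv B z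
      = (cq_deriv A z + (- \<i> * g z) *\<^sub>C A z) * qL * B z"
    by (simp add: distrib_right) (simp add: cquat_simps algebra_simps)
  then show "\<exists>p q. cq_deriv A z * qL * B z + A z * qL * cq_deriv B z = p * qL * q"
    by blast
qed

section \<open>Recovering the branch data from the stabiliser condition\<close>

lemma Sp1C_map_on_subset: "Sp1C_map_on D A \<Longrightarrow> U \<subseteq> D \<Longrightarrow> Sp1C_map_on U A"
  by (auto simp: Sp1C_map_on_def cq_holomorphic_on_def intro: holomorphic_on_subset)

lemma from_left_branchI:
  assumes D: "open D" "simply_connected D" "z1 \<in> D" and A: "Sp1C_map_on D A"
    and stab: "\<And>z. z \<in> D \<Longrightarrow> cq_conj (A z) * cq_deriv A z \<in> stab_left qL"
  shows "from_left_branch D z1 A"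
proof -
  have hol: "cq_holomorphic_on A D" and Sp: "\<And>z. z \<in> D \<Longrightarrow> A z \<in> Sp1C"
    using A by (auto simp: Sp1C_map_on_def)
  define \<alpha> where "\<alpha> = (\<lambda>z. cq_conj (A z) * cq_deriv A z)"
  have "cq_holomorphic_on \<alpha> D"
    unfolding \<alpha>_def
    by (intro cq_holomorphic_mult cq_holomorphic_conj cq_holomorphic_deriv hol D(1))
  then have fh: "(\<lambda>z. cq1 (\<alpha> z)) holomorphic_on D" "(\<lambda>z. cq3 (\<alpha> z)) holomorphic_on D"
    by (simp_all add: cq_holomorphic_on_def)
  obtain F where F: "primitive_on D (\<lambda>z. cq1 (\<alpha> z)) F" "F z1 = 0"
    using primitive_on_exists[OF D(1,2) fh(1)] by blast
  have "cq_deriv A z = A z * (cq1 (\<alpha> z) *\<^sub>C qe1 + cq3 (\<alpha> z) *\<^sub>C N_minus)" if z: "z \<in> D" for z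
  proof -
    have "A z * \<alpha> z = cq_deriv A z"
      using Sp1C_conj_right[OF Sp[OF z]] by (simp add: \<alpha>_def flip: mult.assoc)
    then show ?thesis
      using stab_left_qL[of "\<alpha> z"] stab[OF z] by (simp add: \<alpha>_def)
  qed
  then have "left_solution D z1 (\<lambda>z. cq1 (\<alpha> z)) (\<lambda>z. cq3 (\<alpha> z)) (A z1) A"
    using hol by (simp add: left_solution_def)
  \<comment> \<open>The explicit branch is the \<open>Sp1C\<close>-valued reference solution in the
    uniqueness lemma, and the given \<open>A\<close> is the solution compared with it.\<close>
  then have "A z = left_branch D z1 F (\<lambda>z. cq3 (\<alpha> z)) (A z1) z" if "z \<in> D" for z
    using left_solution_unique[OF D(1) _ D(3) that left_branch_solution[OF D fh(2) F]]
      left_branch_Sp1C[OF Sp[OF D(3)]] simply_connected_imp_connected[OF D(2)] by blast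
  then show ?thesis
    unfolding from_left_branch_def using fh F Sp[OF D(3)] by blast
qed

lemma from_right_branchI:
  assumes D: "open D" "simply_connected D" "z1 \<in> D" and B: "Sp1C_map_on D B"
    and stab: "\<And>z. z \<in> D \<Longrightarrow> cq_deriv B z * cq_conj (B z) \<in> stab_right qL"
  shows "from_right_branch D z1 B"
proof -
  have hol: "cq_holomorphic_on B D" and Sp: "\<And>z. z \<in> D \<Longrightarrow> B z \<in> Sp1C"
    using B by (auto simp: Sp1C_map_on_def)
  define \<beta> where "\<beta> = (\<lambda>z. cq_deriv B z * cq_conj (B z))"
  have "cq_holomorphic_on \<beta> D"
    unfolding \<beta>_def
    by (intro cq_holomorphic_mult cq_holomorphic_conj cq_holomorphic_deriv hol D(1))
  then have gk: "(\<lambda>z. cq1 (\<beta> z)) holomorphic_on D" "(\<lambda>z. cq3 (\<beta> z)) holomorphic_on D"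
    by (simp_all add: cq_holomorphic_on_def)
  obtain G where G: "primitive_on D (\<lambda>z. cq1 (\<beta> z)) G" "G z1 = 0"
    using primitive_on_exists[OF D(1,2) gk(1)] by blast
  have "cq_deriv B z = (cq1 (\<beta> z) *\<^sub>C qe1 + cq3 (\<beta> z) *\<^sub>C N_plus) * B z" if z: "z \<in> D" for z
  proof -
    have "\<beta> z * B z = cq_deriv B z"
      using Sp1C_conj_left[OF Sp[OF z]] by (simp add: \<beta>_def mult.assoc)
    then show ?thesis
      using stab_right_qL[of "\<beta> z"] stab[OF z] by (simp add: \<beta>_def)
  qed
  then have "right_solution D z1 (\<lambda>z. cq1 (\<beta> z)) (\<lambda>z. cq3 (\<beta> z)) (B z1) B"
    using hol by (simp add: right_solution_def)
  then have "B z = right_branch D z1 G (\<lambda>z. cq3 (\<beta> z)) (B z1) z" if "z \<in> D" for z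
    using right_solution_unique[OF D(1) _ D(3) that right_branch_solution[OF D gk(2) G]]
      right_branch_Sp1C[OF Sp[OF D(3)]] simply_connected_imp_connected[OF D(2)] by blast
  then show ?thesis
    unfolding from_right_branch_def using gk G Sp[OF D(3)] by blast
qed

text \<open>A ball, being convex, reduces the local converse to the simply connected case.\<close>

lemma simply_connected_neighbourhood:
  fixes D :: "complex set"
  assumes "open D" "z1 \<in> D"
  obtains U where "open U" "connected U" "simply_connected U" "z1 \<in> U" "U \<subseteq> D"
proof -
  obtain r where "r > 0" "ball z1 r \<subseteq> D"
    using assms open_contains_ball by blast
  then show thesis
    using that[of "ball z1 r"] convex_imp_simply_connected[OF convex_ball] by auto
qed

text \<open>Existence of \<open>F\<close>, \<open>G\<close> and \<open>P\<close> is asserted beside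
  the claims about all such primitives, so that these are not vacuous.\<close>

theorem proposition4p12:
  fixes M :: "complex set" and z0 :: complex
  assumes "open M" and "connected M" and "simply_connected M" and "z0 \<in> M"
  shows
    "(\<forall>f h A0 B. f holomorphic_on M \<and> h holomorphic_on M \<and> A0 \<in> Sp1C \<and> Sp1C_map_on M B \<longrightarrow>
        (\<exists>F. primitive_on M f F \<and> F z0 = 0) \<and>
        (\<forall>F. primitive_on M f F \<and> F z0 = 0 \<longrightarrow>
          (let A = left_branch M z0 F h A0; \<Phi> = (\<lambda>z. A z * qL * B z) in
            left_solution M z0 f h A0 A \<and>
            (\<forall>A'. left_solution M z0 f h A0 A' \<longrightarrow> (\<forall>z\<in>M. A' z = A z)) \<and>
            (\<forall>z\<in>M. cq_symm (A z) = 1) \<and>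
            null_curve_on M \<Phi> \<and> (\<forall>z\<in>M. \<Phi> z \<noteq> 0) \<and>
            (\<exists>P. cq_primitive_on M \<Phi> P) \<and>
            (\<forall>P. cq_primitive_on M \<Phi> P \<longrightarrow> superminimal_on M (\<lambda>z. cq_Re (P z))))))
     \<and>
     (\<forall>g k B0 A. g holomorphic_on M \<and> k holomorphic_on M \<and> B0 \<in> Sp1C \<and> Sp1C_map_on M A \<longrightarrow>
        (\<exists>G. primitive_on M g G \<and> G z0 = 0) \<and>
        (\<forall>G. primitive_on M g G \<and> G z0 = 0 \<longrightarrow>
          (let B = right_branch M z0 G k B0; \<Phi> = (\<lambda>z. A z * qL * B z) in
            right_solution M z0 g k B0 B \<and>
            (\<forall>B'. right_solution M z0 g k B0 B' \<longrightarrow> (\<forall>z\<in>M. B' z = B z)) \<and>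
            (\<forall>z\<in>M. cq_symm (B z) = 1) \<and>
            (\<exists>P. cq_primitive_on M \<Phi> P) \<and>
            (\<forall>P. cq_primitive_on M \<Phi> P \<longrightarrow>
               conformal_minimal_immersion_on M (\<lambda>z. cq_Re (P z)) \<and>
               superminimal_on M (\<lambda>z. cq_Re (P z))))))
     \<and>
     (\<forall>D z1 A B. open D \<and> connected D \<and> z1 \<in> D \<and> superminimal_representation_on D A qL B \<longrightarrow>
        ((\<forall>z\<in>D. cq_conj (A z) * cq_deriv A z \<in> stab_left qL) \<longrightarrow>
           (\<exists>U. open U \<and> connected U \<and> simply_connected U \<and> z1 \<in> U \<and> U \<subseteq> D \<and>
                from_left_branch U z1 A) \<and>
           (simply_connected D \<longrightarrow> from_left_branch D z1 A)) \<and>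
        ((\<forall>z\<in>D. cq_deriv B z * cq_conj (B z) \<in> stab_right qL) \<longrightarrow>
           (\<exists>U. open U \<and> connected U \<and> simply_connected U \<and> z1 \<in> U \<and> U \<subseteq> D \<and>
                from_right_branch U z1 B) \<and>
           (simply_connected D \<longrightarrow> from_right_branch D z1 B)))"
proof (intro conjI allI impI; (elim conjE)?)
  show "\<exists>F. primitive_on M f F \<and> F z0 = 0" if "f holomorphic_on M" for f
    by (rule primitive_on_exists[OF assms(1,3) that])
  show "\<exists>G. primitive_on M g G \<and> G z0 = 0" if "g holomorphic_on M" for g
    by (rule primitive_on_exists[OF assms(1,3) that])
next
  fix f h A0 B F
  assume h: "h holomorphic_on M" and A0: "A0 \<in> Sp1C" and B: "Sp1C_map_on M B"
    and F: "primitive_on M f F" "F z0 = 0"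
  define A where "A = left_branch M z0 F h A0"
  have sol: "left_solution M z0 f h A0 A"
    unfolding A_def by (rule left_branch_solution[OF assms(1,3,4) h F])
  have Sp: "A z \<in> Sp1C" for z
    unfolding A_def by (rule left_branch_Sp1C[OF A0])
  have A: "Sp1C_map_on M A"
    using sol Sp by (simp add: Sp1C_map_on_def left_solution_def)
  have null: "null_curve_on M (\<lambda>z. A z * qL * B z)"
    by (rule null_curve_representation[OF A B])
  have "\<forall>z\<in>M. A z * qL * B z \<noteq> 0"
    using B Sp Sp1C_sandwich_nonzero by (auto simp: Sp1C_map_on_def)
  moreover have "\<exists>P. cq_primitive_on M (\<lambda>z. A z * qL * B z) P"
    using null cq_primitive_on_exists[OF assms(1,3)] by (simp add: null_curve_on_def)
  moreover have "\<forall>z\<in>M. cq_symm (A z) = 1"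
    using Sp by (simp add: Sp1C_def)
  ultimately show "let A = left_branch M z0 F h A0; \<Phi> = (\<lambda>z. A z * qL * B z) in
            left_solution M z0 f h A0 A \<and>
            (\<forall>A'. left_solution M z0 f h A0 A' \<longrightarrow> (\<forall>z\<in>M. A' z = A z)) \<and>
            (\<forall>z\<in>M. cq_symm (A z) = 1) \<and>
            null_curve_on M \<Phi> \<and> (\<forall>z\<in>M. \<Phi> z \<noteq> 0) \<and>
            (\<exists>P. cq_primitive_on M \<Phi> P) \<and>
            (\<forall>P. cq_primitive_on M \<Phi> P \<longrightarrow> superminimal_on M (\<lambda>z. cq_Re (P z)))"
    unfolding Let_def A_def[symmetric]
    using sol null left_solution_unique[OF assms(1,2,4) _ sol Sp]
      left_solution_superminimal[OF assms(1) A B sol] by blast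
next
  fix g k B0 A G
  assume k: "k holomorphic_on M" and B0: "B0 \<in> Sp1C" and A: "Sp1C_map_on M A"
    and G: "primitive_on M g G" "G z0 = 0"
  define B where "B = right_branch M z0 G k B0"
  have sol: "right_solution M z0 g k B0 B"
    unfolding B_def by (rule right_branch_solution[OF assms(1,3,4) k G])
  have Sp: "B z \<in> Sp1C" for z
    unfolding B_def by (rule right_branch_Sp1C[OF B0])
  have B: "Sp1C_map_on M B"
    using sol Sp by (simp add: Sp1C_map_on_def right_solution_def)
  have "\<exists>P. cq_primitive_on M (\<lambda>z. A z * qL * B z) P"
    using null_curve_representation[OF A B] cq_primitive_on_exists[OF assms(1,3)]
    by (simp add: null_curve_on_def)
  moreover have "\<forall>z\<in>M. cq_symm (B z) = 1"
    using Sp by (simp add: Sp1C_def)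
  ultimately show "let B = right_branch M z0 G k B0; \<Phi> = (\<lambda>z. A z * qL * B z) in
            right_solution M z0 g k B0 B \<and>
            (\<forall>B'. right_solution M z0 g k B0 B' \<longrightarrow> (\<forall>z\<in>M. B' z = B z)) \<and>
            (\<forall>z\<in>M. cq_symm (B z) = 1) \<and>
            (\<exists>P. cq_primitive_on M \<Phi> P) \<and>
            (\<forall>P. cq_primitive_on M \<Phi> P \<longrightarrow>
               conformal_minimal_immersion_on M (\<lambda>z. cq_Re (P z)) \<and>
               superminimal_on M (\<lambda>z. cq_Re (P z)))"
    unfolding Let_def B_def[symmetric]
    using sol right_solution_unique[OF assms(1,2,4) _ sol Sp]
      right_solution_superminimal[OF assms(1) A B sol] superminimal_on_def by blast
next
  fix D z1 A B
  assume D: "open D" "z1 \<in> D" and rep: "superminimal_representation_on D A qL B"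
  have A: "Sp1C_map_on D A" and B: "Sp1C_map_on D B"
    using rep by (auto simp: superminimal_representation_on_def)
  \<comment> \<open>The same neighbourhood serves the left and the right case.\<close>
  obtain U where U: "open U" "connected U" "simply_connected U" "z1 \<in> U" "U \<subseteq> D"
    using simply_connected_neighbourhood[OF D] .
  {
    assume stab: "\<forall>z\<in>D. cq_conj (A z) * cq_deriv A z \<in> stab_left qL"
    show "\<exists>U. open U \<and> connected U \<and> simply_connected U \<and> z1 \<in> U \<and> U \<subseteq> D \<and> from_left_branch U z1 A"
      using U from_left_branchI[OF U(1,3,4) Sp1C_map_on_subset[OF A U(5)]] stab by blast
    show "from_left_branch D z1 A" if "simply_connected D"
      using from_left_branchI[OF D(1) that D(2) A] stab by blast
  next
    assume stab: "\<forall>z\<in>D. cq_deriv B z * cq_conj (B z) \<in> stab_right qL"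
    show "\<exists>U. open U \<and> connected U \<and> simply_connected U \<and> z1 \<in> U \<and> U \<subseteq> D \<and> from_right_branch U z1 B"
      using U from_right_branchI[OF U(1,3,4) Sp1C_map_on_subset[OF B U(5)]] stab by blast
    show "from_right_branch D z1 B" if "simply_connected D"
      using from_right_branchI[OF D(1) that D(2) B] stab by blast
  }
qed

end
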